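(* For every $a\in\mathbb{C}$ with $a+\tfrac12\notin\{0,-1,-2,\dots\}$, $$F\!\left(a,2a-\tfrac12;a+\tfrac12;3-2\sqrt2\right)=\frac{2^{3/4-3a}\,(\sqrt2-1)^{1/2-2a}\sqrt{\pi}\;\Gamma(a+\tfrac12)}{\Gamma(\tfrac12a+\tfrac38)\,\Gamma(\tfrac12a+\tfrac58)}.$$
   Context: $F(a,b;c;x)=\sum_{n\ge0}\frac{(a,n)(b,n)}{(c,n)(1,n)}x^n$ with $(\alpha,n)=\Gamma(\alpha+n)/\Gamma(\alpha)$ is the Gauss hypergeometric series. For $t>0$ and $s\in\mathbb{C}$, $t^s=e^{s\log t}$ with real logarithm. $1/\Gamma$ is interpreted as $0$ at the poles of $\Gamma$. *)

theory Defs
  imports "HOL-Analysis.Analysis"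
begin

(* The symbol (\<alpha>,n) = \<Gamma>(\<alpha>+n)/\<Gamma>(\<alpha>) is pochhammer \<alpha> n: see pochhammer_Gamma. At the poles
   of \<Gamma>, where the library totalises Gamma to 0, pochhammer gives the intended limit value,
   i.e. the product \<alpha>(\<alpha>+1)...(\<alpha>+n-1). Meaningful for c not in {0,-1,-2,...}, norm x < 1. *)
definition gauss_F :: "complex \<Rightarrow> complex \<Rightarrow> complex \<Rightarrow> complex \<Rightarrow> complex" where
  "gauss_F a b c x =
     (\<Sum>n. pochhammer a n * pochhammer b n / (pochhammer c n * pochhammer 1 n) * x ^ n)"

lemma gauss_F_eq_eval_fps_hypergeo:
  "gauss_F a b c x = eval_fps (fps_hypergeo [a, b] [c] 1) x"
  by (simp add: gauss_F_def eval_fps_def flip: pochhammer_fact)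

end

theory Submission
  imports Defs "HOL-Complex_Analysis.Complex_Analysis" "HOL-Real_Asymp.Real_Asymp"
begin

text \<open>
  The argument $x_0 = 3 - 2\sqrt 2$ is special because it is a critical point, with critical value
  $1$, of the rational map $w(z) = 16 z (1-z)^2 / (1+z)^4$: indeed
  $1 - w(z) = (1 - 6z + z^2)^2 / (1+z)^4$ and $x_0$ is the smaller root of $1 - 6z + z^2$.
  With $p = 2a - 1/2$, the map $w$ induces the transformation
  \[ F(p, a; a + 1/2; z) = (1+z)^{-p}\, F(a/2 - 1/8,\, a/2 + 1/8;\, a + 1/2;\, w(z)) , \]
  the composite of the two classical quadratic transformations $z \mapsto 4z/(1+z)^2$ and
  $y \mapsto 4y(1-y)$. As $z$ increases to $x_0$, $w(z)$ increases to $1$, and the right-hand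
  series is still continuous there, since its parameter excess $c - \alpha - \beta$ is $1/2$. So the
  left-hand value at $x_0$ is $(1+x_0)^{-p}$ times a series at $1$, which Gauss's summation theorem
  expresses through the Gamma function, and $1 + x_0 = 2\sqrt 2\,(\sqrt 2 - 1)$ gives the remaining
  elementary factors.

  Gauss's theorem (\<open>gauss_F_1\<close>) follows from the contiguous relation between $F(a,b;c;1)$ and
  $F(a,b;c+1;1)$: iterating it pushes $c$ to infinity, where the series tends to $1$, while the
  accumulated Pochhammer quotients tend to Gamma quotients. The transformation
  (\<open>gauss_F_pullback\<close>) holds because both sides satisfy the same hypergeometric equation near
  $0$, whose power series solution is determined by its constant term unless $c$ is a nonpositive
  integer; it then extends by the identity theorem along $[0, x_0)$.
\<close>

section \<open>The hypergeometric series in the closed unit disc\<close>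

definition gauss_fps :: "complex \<Rightarrow> complex \<Rightarrow> complex \<Rightarrow> complex fps" where
  "gauss_fps a b c = fps_hypergeo [a, b] [c] 1"

lemma gauss_fps_nth:
  "fps_nth (gauss_fps a b c) n = pochhammer a n * pochhammer b n / (pochhammer c n * fact n)"
  by (simp add: gauss_fps_def)

lemma gauss_F_eq_eval_fps: "gauss_F a b c = eval_fps (gauss_fps a b c)"
  by (simp add: fun_eq_iff gauss_fps_def gauss_F_eq_eval_fps_hypergeo)

lemma gauss_fps_nth_0: "fps_nth (gauss_fps a b c) 0 = 1"
  by (simp add: gauss_fps_nth)

lemma add_of_nat_neq_0:
  assumes "(c :: complex) \<notin> \<int>\<^sub>\<le>\<^sub>0"
  shows "c + of_nat n \<noteq> 0"
  using assms by (metis add.inverse_inverse add_eq_0_iff2 minus_of_nat_in_nonpos_Ints)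

lemma gauss_fps_nth_Suc:
  assumes "c \<notin> \<int>\<^sub>\<le>\<^sub>0"
  shows "of_nat (Suc n) * (c + of_nat n) * fps_nth (gauss_fps a b c) (Suc n) =
           (a + of_nat n) * (b + of_nat n) * fps_nth (gauss_fps a b c) n"
proof -
  have "pochhammer c n \<noteq> 0"
    using assms by (auto simp: pochhammer_eq_0_iff)
  with add_of_nat_neq_0[OF assms, of n] show ?thesis
    by (simp add: gauss_fps_nth pochhammer_Suc divide_simps del: of_nat_Suc)
qed

text \<open>
  By Euler's limit formula a Pochhammer symbol is a convergent factor times a factorial and a
  power of \<open>n\<close>. The limit of that factor is a value of \<open>rGamma\<close>, which may be zero in the numerator,
  so the bound also covers terminating series, for which ratio-type arguments would divide by zero.
\<close>
lemma gauss_fps_nth_bigo: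
  assumes "c \<notin> \<int>\<^sub>\<le>\<^sub>0"
  shows "(\<lambda>n. norm (fps_nth (gauss_fps a b c) (Suc n))) \<in> O(\<lambda>n. real n powr (Re (a + b - c) - 1))"
proof -
  let ?q = "\<lambda>n. rGamma_series a n * rGamma_series b n / rGamma_series c n"
  have "?q \<longlonglongrightarrow> rGamma a * rGamma b / rGamma c"
    using assms by (intro tendsto_intros) (auto simp: rGamma_eq_zero_iff)
  hence "Bseq ?q"
    by (intro convergent_imp_Bseq convergentI)
  then obtain K where K: "K > 0" "\<And>n. norm (?q n) \<le> K"
    by (auto elim: BseqE)
  have "norm (norm (fps_nth (gauss_fps a b c) (Suc n))) \<le> K * norm (real n powr (Re (a + b - c) - 1))"
    if n: "n > 0" for n
  proof -
    have "fps_nth (gauss_fps a b c) (Suc n) =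
            ?q n * (exp ((a + b - c) * of_real (ln (real n))) / of_nat (Suc n))"
      using n by (simp add: gauss_fps_nth rGamma_series_def divide_simps exp_add exp_diff ring_distribs
          del: of_nat_Suc)
    hence "norm (fps_nth (gauss_fps a b c) (Suc n)) =
             norm (?q n) * (exp (Re (a + b - c) * ln (real n)) / real (Suc n))"
      by (simp add: norm_mult norm_divide del: of_nat_Suc)
    also have "\<dots> \<le> K * (exp (Re (a + b - c) * ln (real n)) / real n)"
      using n by (intro mult_mono K divide_left_mono) (auto intro: less_imp_le K)
    also have "exp (Re (a + b - c) * ln (real n)) / real n = real n powr (Re (a + b - c) - 1)"
      using n by (simp only: powr_diff) (simp add: powr_def)
    finally show ?thesis by simp
  qed
  thus ?thesis
    by (intro landau_o.bigI[of K] K eventually_mono[OF eventually_gt_at_top[of 0]])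
qed

lemma fps_conv_radius_gauss_fps:
  assumes "c \<notin> \<int>\<^sub>\<le>\<^sub>0"
  shows "fps_conv_radius (gauss_fps a b c) \<ge> 1"
  unfolding fps_conv_radius_def
proof (rule conv_radius_geI_ex')
  fix r :: real
  assume r: "0 < r" "ereal r < 1"
  hence r': "r < 1" by simp
  define s where "s = Re (a + b - c) - 1"
  have "(\<lambda>n. norm (fps_nth (gauss_fps a b c) (Suc n)) * r ^ n) \<in> O(\<lambda>n. real n powr s * r ^ n)"
    unfolding s_def by (intro landau_o.big.mult gauss_fps_nth_bigo assms) auto
  also have "(\<lambda>n. real n powr s * r ^ n) \<in> O(\<lambda>n. 1 / real n ^ 2)"
    using r r' by real_asymp
  finally have "summable (\<lambda>n. norm (fps_nth (gauss_fps a b c) (Suc n)) * r ^ n)"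
    by (rule summable_comparison_test_bigo[rotated])
       (use inverse_power_summable[of 2, where 'a = real] in \<open>simp add: field_simps\<close>)
  hence "summable (\<lambda>n. r * (norm (fps_nth (gauss_fps a b c) (Suc n)) * r ^ n))"
    by (rule summable_mult)
  hence "summable (\<lambda>n. norm (fps_nth (gauss_fps a b c) (Suc n) * of_real r ^ Suc n))"
    using r by (simp add: norm_mult norm_power mult_ac)
  hence "summable (\<lambda>n. fps_nth (gauss_fps a b c) (Suc n) * of_real r ^ Suc n)"
    by (rule summable_norm_cancel)
  thus "summable (\<lambda>n. fps_nth (gauss_fps a b c) n * of_real r ^ n)"
    by (subst (asm) summable_Suc_iff)
qed

lemma holomorphic_gauss_F:
  assumes "c \<notin> \<int>\<^sub>\<le>\<^sub>0"
  shows "gauss_F a b c holomorphic_on ball 0 1"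
  unfolding gauss_F_eq_eval_fps
  by (rule holomorphic_on_subset[OF holomorphic_on_eval_fps[OF subset_refl]])
     (use fps_conv_radius_gauss_fps[OF assms, of a b]
      in \<open>auto simp: eball_def one_ereal_def intro: less_le_trans[of _ "ereal 1"]\<close>)

lemma summable_gauss_fps_nth:
  assumes "c \<notin> \<int>\<^sub>\<le>\<^sub>0" "Re (c - a - b) > 0"
  shows "summable (\<lambda>n. norm (fps_nth (gauss_fps a b c) n))"
proof -
  have "summable (\<lambda>n. norm (real n powr (Re (a + b - c) - 1)))"
    using assms(2) by (simp add: summable_real_powr_iff)
  hence "summable (\<lambda>n. norm (fps_nth (gauss_fps a b c) (Suc n)))"
    by (rule summable_comparison_test_bigo) (rule gauss_fps_nth_bigo[OF assms(1)])
  thus ?thesis by (subst (asm) summable_Suc_iff)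
qed

lemma gauss_F_at_1: "gauss_F a b c 1 = (\<Sum>n. fps_nth (gauss_fps a b c) n)"
  by (simp add: gauss_F_eq_eval_fps eval_fps_def)

text \<open>
  Continuity up to the boundary is what makes the value at \<open>1\<close> accessible as a limit from inside
  the disc.
\<close>
lemma continuous_on_gauss_F:
  assumes "c \<notin> \<int>\<^sub>\<le>\<^sub>0" "Re (c - a - b) > 0"
  shows "continuous_on (cball 0 1) (gauss_F a b c)"
proof -
  let ?f = "fps_nth (gauss_fps a b c)"
  have "uniform_limit (cball 0 1) (\<lambda>n x. \<Sum>i<n. ?f i * x ^ i) (\<lambda>x. \<Sum>i. ?f i * x ^ i) sequentially"
  proof (rule Weierstrass_m_test)
    fix n :: nat and x :: complex
    assume "x \<in> cball 0 1"
    hence "norm x ^ n \<le> 1" by (intro power_le_one) auto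
    thus "norm (?f n * x ^ n) \<le> norm (?f n)"
      by (simp add: norm_mult norm_power mult_left_le)
  qed (rule summable_gauss_fps_nth[OF assms])
  hence "continuous_on (cball 0 1) (\<lambda>x. \<Sum>i. ?f i * x ^ i)"
    by (rule uniform_limit_theorem[rotated])
       (auto intro!: always_eventually continuous_intros)
  thus ?thesis
    by (simp add: gauss_F_eq_eval_fps eval_fps_def [abs_def])
qed

section \<open>Gauss's summation theorem\<close>

lemma plus_of_nat_notin_nonpos_Ints:
  assumes "(c :: complex) \<notin> \<int>\<^sub>\<le>\<^sub>0"
  shows "c + of_nat n \<notin> \<int>\<^sub>\<le>\<^sub>0"
proof
  assume "c + of_nat n \<in> \<int>\<^sub>\<le>\<^sub>0"
  then obtain k where "c + of_nat n = - of_nat k"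
    by (elim nonpos_Ints_cases')
  hence "c = - of_nat (k + n)"
    by (simp add: algebra_simps)
  with assms minus_of_nat_in_nonpos_Ints[of "k + n"] show False by metis
qed

text \<open>
  Termwise, the difference of the two sides telescopes with \<open>U n = - c * n * A n\<close>, where \<open>A n\<close> is
  the coefficient of the left-hand series. The positivity of the parameter excess makes the
  boundary term vanish at infinity, because \<open>A n\<close> then decays faster than \<open>1 / n\<close>.
\<close>
lemma gauss_F_1_contiguous:
  assumes c: "c \<notin> \<int>\<^sub>\<le>\<^sub>0" and pos: "Re (c - a - b) > 0"
  shows "c * (c - a - b) * gauss_F a b c 1 = (c - a) * (c - b) * gauss_F a b (c + 1) 1"
proof -
  let ?A = "fps_nth (gauss_fps a b c)" and ?B = "fps_nth (gauss_fps a b (c + 1))"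
  have c1: "c + 1 \<notin> \<int>\<^sub>\<le>\<^sub>0"
    using plus_of_nat_notin_nonpos_Ints[OF c, of 1] by simp
  have c0: "c \<noteq> 0" using c by auto
  have sA: "?A sums gauss_F a b c 1"
    unfolding gauss_F_at_1
    by (rule summable_sums[OF summable_norm_cancel[OF summable_gauss_fps_nth[OF c pos]]])
  have sB: "?B sums gauss_F a b (c + 1) 1"
    unfolding gauss_F_at_1
    by (rule summable_sums[OF summable_norm_cancel[OF summable_gauss_fps_nth[OF c1]]])
       (use pos in simp)
  define U where "U = (\<lambda>n. - c * of_nat n * ?A n)"
  have tele: "c * (c - a - b) * ?A n - (c - a) * (c - b) * ?B n = U (Suc n) - U n" for n
  proof -
    have nz: "c + of_nat n \<noteq> 0" by (rule add_of_nat_neq_0[OF c])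
    have "(c + of_nat n) * pochhammer c n = c * pochhammer (c + 1) n"
      using pochhammer_rec[of c n] pochhammer_Suc[of c n] by (simp add: mult_ac)
    hence "pochhammer (c + 1) n = (c + of_nat n) * pochhammer c n / c"
      using c0 by (simp add: field_simps)
    hence B: "(c + of_nat n) * ?B n = c * ?A n"
      using nz c0 by (simp add: gauss_fps_nth)
    have S: "(c + of_nat n) * U (Suc n) = - c * ((a + of_nat n) * (b + of_nat n) * ?A n)"
      by (subst gauss_fps_nth_Suc[OF c, symmetric]) (simp add: U_def algebra_simps)
    have "(c + of_nat n) * (c * (c - a - b) * ?A n - (c - a) * (c - b) * ?B n) =
          (c + of_nat n) * (c * (c - a - b) * ?A n) - (c - a) * (c - b) * ((c + of_nat n) * ?B n)"
      by (simp add: algebra_simps)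
    also have "\<dots> = (c + of_nat n) * U (Suc n) - (c + of_nat n) * U n"
      unfolding B S by (simp add: U_def algebra_simps)
    finally show ?thesis
      using nz by (simp flip: right_diff_distrib)
  qed
  have "(\<lambda>n. norm (U (Suc n))) \<longlonglongrightarrow> 0"
  proof -
    define s where "s = Re (a + b - c) - 1"
    have s: "s < -1" using pos by (simp add: s_def)
    have "(\<lambda>n. norm c * real (Suc n) * norm (?A (Suc n))) \<in> O(\<lambda>n. norm c * real (Suc n) * real n powr s)"
      unfolding s_def by (intro landau_o.big.mult gauss_fps_nth_bigo c) auto
    also have "(\<lambda>n. norm c * real (Suc n) * real n powr s) \<in> o(\<lambda>_. 1)"
      using s c0 by real_asymp
    finally have "(\<lambda>n. norm c * real (Suc n) * norm (?A (Suc n))) \<in> o(\<lambda>_. 1)" .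
    from smalloD_tendsto[OF this] show ?thesis
      by (simp add: U_def norm_mult del: of_nat_Suc)
  qed
  hence "(\<lambda>n. U (Suc n)) \<longlonglongrightarrow> 0"
    by (rule tendsto_norm_zero_cancel)
  hence "U \<longlonglongrightarrow> 0"
    by (simp only: filterlim_sequentially_Suc)
  hence "(\<lambda>n. U (Suc n) - U n) sums (0 - U 0)"
    by (rule telescope_sums)
  moreover have "(\<lambda>n. U (Suc n) - U n) sums
      (c * (c - a - b) * gauss_F a b c 1 - (c - a) * (c - b) * gauss_F a b (c + 1) 1)"
    unfolding tele[symmetric] by (intro sums_diff sums_mult sA sB)
  ultimately show ?thesis
    by (simp add: sums_iff U_def)
qed

lemma gauss_F_1_contiguous_iterated:
  assumes c: "c \<notin> \<int>\<^sub>\<le>\<^sub>0" and pos: "Re (c - a - b) > 0"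
  shows "pochhammer c n * pochhammer (c - a - b) n * gauss_F a b c 1 =
           pochhammer (c - a) n * pochhammer (c - b) n * gauss_F a b (c + of_nat n) 1"
proof (induction n)
  case (Suc n)
  have "(c + of_nat n) * (c + of_nat n - a - b) * gauss_F a b (c + of_nat n) 1 =
        (c + of_nat n - a) * (c + of_nat n - b) * gauss_F a b (c + of_nat n + 1) 1"
    using pos by (intro gauss_F_1_contiguous plus_of_nat_notin_nonpos_Ints c) auto
  thus ?case
    using Suc.IH by (simp add: pochhammer_Suc add_ac) algebra
qed auto

lemma pochhammer_real_nonneg: "r \<ge> 0 \<Longrightarrow> pochhammer (r :: real) n \<ge> 0"
  by (induction n) (auto simp: pochhammer_Suc)

lemma norm_pochhammer_le: "norm (pochhammer (z :: complex) n) \<le> pochhammer (norm z) n"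
proof (induction n)
  case (Suc n)
  have "norm (z + of_nat n) \<le> norm z + real n"
    using norm_triangle_ineq[of z "of_nat n"] by simp
  with Suc have "norm (pochhammer z n) * norm (z + of_nat n) \<le> pochhammer (norm z) n * (norm z + real n)"
    by (rule mult_mono) (auto intro: order_trans[OF norm_ge_zero Suc])
  thus ?case
    by (simp add: pochhammer_Suc norm_mult)
qed auto

lemma norm_pochhammer_ge:
  assumes "0 < x" "x \<le> Re z"
  shows "pochhammer x n \<le> norm (pochhammer z n)"
proof (induction n)
  case (Suc n)
  have "x + real n \<le> norm (z + of_nat n)"
    using assms complex_Re_le_cmod[of "z + of_nat n"] by simp
  with Suc show ?case
    using assms by (auto simp: pochhammer_Suc norm_mult intro!: mult_mono pochhammer_nonneg)
qed auto

lemma tendsto_inverse_pochhammer: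
  "(\<lambda>m. inverse (pochhammer (c + of_nat m :: complex) n)) \<longlonglongrightarrow> (if n = 0 then 1 else 0)"
proof (induction n)
  case (Suc n)
  have "filterlim (\<lambda>m. of_nat m + (c + of_nat n)) at_infinity sequentially"
    by (intro tendsto_add_filterlim_at_infinity' tendsto_of_nat) auto
  hence "(\<lambda>m. inverse (of_nat m + (c + of_nat n))) \<longlonglongrightarrow> 0"
    by (rule filterlim_compose[OF tendsto_inverse_0])
  from tendsto_mult[OF Suc this] show ?case
    by (simp add: pochhammer_Suc add_ac)
qed auto

text \<open>
  Tannery's theorem applies: for large \<open>m\<close> the coefficients are dominated by those of a convergent
  series with positive real parameters, because replacing \<open>a\<close> and \<open>b\<close> by their norms enlarges the
  numerators and replacing \<open>c + m\<close> by a smaller positive lower bound of its real part shrinks the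
  denominators.
\<close>
lemma tendsto_gauss_F_1:
  "(\<lambda>m. gauss_F a b (c + of_nat m) 1) \<longlonglongrightarrow> 1"
proof -
  obtain m0 :: nat where m0: "real m0 > norm a + norm b - Re c + norm c"
    using reals_Archimedean2 by blast
  (* positive, and large enough for the majorant to have positive parameter excess *)
  define x where "x = Re c + real m0"
  have x: "x > norm a + norm b" "x > 0"
    using m0 abs_Re_le_cmod[of c] norm_ge_zero[of a] norm_ge_zero[of b] unfolding x_def by linarith+
  define M where "M = (\<lambda>n. norm (fps_nth (gauss_fps (of_real (norm a)) (of_real (norm b)) (of_real x)) n))"
  have M: "M n = pochhammer (norm a) n * pochhammer (norm b) n / (pochhammer x n * fact n)" for n
    using x(2) by (simp add: M_def gauss_fps_nth pochhammer_of_real norm_mult norm_divide pochhammer_real_nonneg)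
  have "of_real x \<notin> (\<int>\<^sub>\<le>\<^sub>0 :: complex set)"
    using x by (auto elim!: nonpos_Ints_cases simp: complex_eq_iff)
  hence sM: "summable M"
    unfolding M_def using x by (intro summable_gauss_fps_nth) auto
  have bound: "norm (fps_nth (gauss_fps a b (c + of_nat m)) n) \<le> M n" if "m \<ge> m0" for m n
    unfolding M gauss_fps_nth norm_mult norm_divide
    using that x
    by (intro frac_le mult_mono norm_pochhammer_le norm_pochhammer_ge mult_pos_pos pochhammer_pos
          mult_nonneg_nonneg pochhammer_real_nonneg)
       (auto simp: x_def intro!: norm_pochhammer_ge)
  have "(\<lambda>m. \<Sum>n. fps_nth (gauss_fps a b (c + of_nat m)) n) \<longlonglongrightarrow> (\<Sum>n. if n = 0 then 1 else 0)"
  proof (rule tannerys_theorem[THEN conjunct2, THEN conjunct2])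
    fix n
    have "(\<lambda>m. pochhammer a n * pochhammer b n / fact n * inverse (pochhammer (c + of_nat m) n))
            \<longlonglongrightarrow> pochhammer a n * pochhammer b n / fact n * (if n = 0 then 1 else 0)"
      by (intro tendsto_mult tendsto_const tendsto_inverse_pochhammer)
    thus "(\<lambda>m. fps_nth (gauss_fps a b (c + of_nat m)) n) \<longlonglongrightarrow> (if n = 0 then 1 else 0)"
      by (cases "n = 0") (simp_all add: gauss_fps_nth field_simps)
  next
    have "eventually (\<lambda>m. m \<ge> m0) sequentially" by (rule eventually_ge_at_top)
    thus "eventually (\<lambda>(n, m). norm (fps_nth (gauss_fps a b (c + of_nat m)) n) \<le> M n)
            (sequentially \<times>\<^sub>F sequentially)"
      unfolding eventually_prod_filter
      by (intro exI[of _ "\<lambda>_. True"] exI[of _ "\<lambda>m. m \<ge> m0"]) (auto intro: bound)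
  qed (auto simp: sM)
  moreover have "(\<Sum>n. if n = 0 then 1 else 0 :: complex) = 1"
    using suminf_finite[of "{0::nat}" "\<lambda>n. if n = 0 then 1 else 0 :: complex"] by simp
  ultimately show ?thesis
    by (simp add: gauss_F_at_1)
qed

text \<open>
  In the iterated contiguous relation the parameters on both sides have the same sum,
  \<open>c + (c - a - b) = (c - a) + (c - b)\<close>, so the normalising factors that turn Pochhammer symbols
  into approximants of \<open>rGamma\<close> cancel.
\<close>
theorem gauss_F_1:
  assumes c: "c \<notin> \<int>\<^sub>\<le>\<^sub>0" and pos: "Re (c - a - b) > 0"
  shows "gauss_F a b c 1 = Gamma c * Gamma (c - a - b) * rGamma (c - a) * rGamma (c - b)"
proof -
  have lim: "(\<lambda>n. gauss_F a b (c + of_nat (n + 1)) 1) \<longlonglongrightarrow> 1"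
    by (rule LIMSEQ_ignore_initial_segment[OF tendsto_gauss_F_1])
  have eq: "rGamma_series c n * rGamma_series (c - a - b) n * gauss_F a b c 1 =
        rGamma_series (c - a) n * rGamma_series (c - b) n * gauss_F a b (c + of_nat (n + 1)) 1" for n
  proof -
    define L where "L = (of_real (ln (real n)) :: complex)"
    have "exp (c * L) * exp ((c - a - b) * L) = exp ((c - a) * L) * exp ((c - b) * L)"
      by (simp add: exp_add [symmetric] algebra_simps)
    with gauss_F_1_contiguous_iterated[OF c pos, of "n + 1"]
    have "pochhammer c (n + 1) * pochhammer (c - a - b) (n + 1) * gauss_F a b c 1
              / (fact n * fact n * (exp (c * L) * exp ((c - a - b) * L))) =
          pochhammer (c - a) (n + 1) * pochhammer (c - b) (n + 1) * gauss_F a b (c + of_nat (n + 1)) 1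
              / (fact n * fact n * (exp ((c - a) * L) * exp ((c - b) * L)))"
      by (simp only:)
    moreover have "rGamma_series z n = pochhammer z (n + 1) / (fact n * exp (z * L))" for z
      by (simp add: rGamma_series_def L_def)
    ultimately show ?thesis
      by (simp only: times_divide_eq_right times_divide_eq_left divide_divide_eq_left mult_ac)
  qed
  have "rGamma c * rGamma (c - a - b) * gauss_F a b c 1 = rGamma (c - a) * rGamma (c - b) * 1"
    by (rule LIMSEQ_unique[of "\<lambda>n. rGamma_series c n * rGamma_series (c - a - b) n * gauss_F a b c 1"])
       (intro tendsto_intros, subst eq, intro tendsto_intros lim)
  moreover have "rGamma c \<noteq> 0"
    using c by (simp add: rGamma_eq_zero_iff)
  moreover have "rGamma (c - a - b) \<noteq> 0"
    using pos by (metis complex_nonpos_Reals_iff not_le nonpos_Ints_subset_nonpos_Reals rGamma_eq_zero_iff subsetD)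
  ultimately show ?thesis
    by (simp add: Gamma_def field_simps)
qed


section \<open>The hypergeometric differential equation\<close>

lemma has_fps_expansion_gauss_F:
  assumes "c \<notin> \<int>\<^sub>\<le>\<^sub>0"
  shows "gauss_F a b c has_fps_expansion gauss_fps a b c"
  unfolding gauss_F_eq_eval_fps
  by (intro eval_fps_has_fps_expansion less_le_trans[OF _ fps_conv_radius_gauss_fps[OF assms]]) simp

text \<open>
  The hypergeometric differential operator, on formal power series: there its kernel can be
  read off from a two-term recurrence between neighbouring coefficients.
\<close>
definition hypergeo_op :: "complex \<Rightarrow> complex \<Rightarrow> complex \<Rightarrow> complex fps \<Rightarrow> complex fps" where
  "hypergeo_op a b c f =
     fps_X * (1 - fps_X) * fps_deriv (fps_deriv f)
       + (fps_const c - fps_const (a + b + 1) * fps_X) * fps_deriv f - fps_const (a * b) * f"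

lemma fps_nth_hypergeo_op:
  "fps_nth (hypergeo_op a b c f) n =
     of_nat (Suc n) * (c + of_nat n) * fps_nth f (Suc n) - (a + of_nat n) * (b + of_nat n) * fps_nth f n"
proof -
  have "hypergeo_op a b c f =
     fps_X * fps_deriv (fps_deriv f) - fps_X * (fps_X * fps_deriv (fps_deriv f))
       + fps_const c * fps_deriv f - fps_const (a + b + 1) * (fps_X * fps_deriv f) - fps_const (a * b) * f"
    by (simp add: hypergeo_op_def algebra_simps)
  also have "fps_nth \<dots> n =
     of_nat (Suc n) * (c + of_nat n) * fps_nth f (Suc n) - (a + of_nat n) * (b + of_nat n) * fps_nth f n"
    by (cases n; cases "n - 1") (simp_all add: algebra_simps)
  finally show ?thesis .
qed

lemma hypergeo_op_gauss_fps:
  assumes "c \<notin> \<int>\<^sub>\<le>\<^sub>0"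
  shows "hypergeo_op a b c (gauss_fps a b c) = 0"
  by (simp add: fps_eq_iff fps_nth_hypergeo_op gauss_fps_nth_Suc[OF assms] del: of_nat_Suc)

text \<open>
  The recurrence has leading factor \<open>(n + 1) * (c + n)\<close>, which never vanishes under the condition
  on \<open>c\<close>; the other local exponent \<open>1 - c\<close> therefore contributes no second power series solution.
\<close>
lemma hypergeo_op_unique:
  assumes c: "c \<notin> \<int>\<^sub>\<le>\<^sub>0" and f: "hypergeo_op a b c f = 0" "fps_nth f 0 = 1"
  shows "f = gauss_fps a b c"
proof (rule fps_ext)
  fix n show "fps_nth f n = fps_nth (gauss_fps a b c) n"
  proof (induction n)
    case 0
    thus ?case by (simp add: f(2) gauss_fps_nth_0)
  next
    case (Suc n)
    have "of_nat (Suc n) * (c + of_nat n) * fps_nth f (Suc n) =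
            (a + of_nat n) * (b + of_nat n) * fps_nth f n"
      using fps_nth_hypergeo_op[of a b c f n] f(1) by simp
    also have "\<dots> = of_nat (Suc n) * (c + of_nat n) * fps_nth (gauss_fps a b c) (Suc n)"
      by (simp only: gauss_fps_nth_Suc[OF c] Suc.IH)
    finally show ?case
      using add_of_nat_neq_0[OF c, of n] by (simp del: of_nat_Suc)
  qed
qed

lemma has_fps_expansion_hypergeo_op:
  assumes "f has_fps_expansion F" "f1 has_fps_expansion fps_deriv F"
          "f2 has_fps_expansion fps_deriv (fps_deriv F)"
  shows "(\<lambda>z. z * (1 - z) * f2 z + (c - (a + b + 1) * z) * f1 z - a * b * f z)
           has_fps_expansion hypergeo_op a b c F"
  unfolding hypergeo_op_def by (intro fps_expansion_intros assms)

lemma gauss_F_ode: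
  fixes a b c z :: complex
  assumes c: "c \<notin> \<int>\<^sub>\<le>\<^sub>0" and z: "z \<in> ball 0 1"
  defines "G \<equiv> gauss_F a b c"
  shows "z * (1 - z) * deriv (deriv G) z + (c - (a + b + 1) * z) * deriv G z - a * b * G z = 0"
proof -
  define L where
    "L = (\<lambda>z. z * (1 - z) * deriv (deriv G) z + (c - (a + b + 1) * z) * deriv G z - a * b * G z)"
  have G: "G has_fps_expansion gauss_fps a b c"
    unfolding G_def by (rule has_fps_expansion_gauss_F[OF c])
  have "L has_fps_expansion hypergeo_op a b c (gauss_fps a b c)"
    unfolding L_def by (intro has_fps_expansion_hypergeo_op has_fps_expansion_deriv G)
  hence "L has_fps_expansion 0"
    by (simp add: hypergeo_op_gauss_fps[OF c])
  moreover have "G holomorphic_on ball 0 1"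
    unfolding G_def by (rule holomorphic_gauss_F[OF c])
  hence "L holomorphic_on ball 0 1"
    unfolding L_def by (intro holomorphic_intros holomorphic_deriv) auto
  ultimately have "L z = 0"
    by (rule has_fps_expansion_0_analytic_continuation[where A = "ball 0 1"]) (use z in auto)
  thus ?thesis
    by (simp add: L_def)
qed

text \<open>
  The criterion by which a function given in closed form is recognised as a hypergeometric series:
  a local check of the differential equation and of one value suffices.
\<close>
lemma has_fps_expansion_gauss_fpsI:
  assumes c: "c \<notin> \<int>\<^sub>\<le>\<^sub>0" and r: "r > 0"
    and d1: "\<And>z. z \<in> ball 0 r \<Longrightarrow> (f has_field_derivative f1 z) (at z)"
    and d2: "\<And>z. z \<in> ball 0 r \<Longrightarrow> (f1 has_field_derivative f2 z) (at z)"
    and ode: "\<And>z. z \<in> ball 0 r \<Longrightarrow> z * (1 - z) * f2 z + (c - (a + b + 1) * z) * f1 z - a * b * f z = 0"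
    and f0: "f 0 = 1"
  shows "f has_fps_expansion gauss_fps a b c"
proof -
  define F where "F = fps_expansion f 0"
  have ev: "eventually (\<lambda>z. z \<in> ball 0 r) (nhds (0 :: complex))"
    using r by (intro eventually_nhds_in_open) auto
  have "f holomorphic_on ball 0 r"
    using d1 unfolding holomorphic_on_open[OF open_ball] by blast
  hence F: "f has_fps_expansion F"
    unfolding F_def by (rule has_fps_expansion_fps_expansion[rotated 2]) (use r in auto)
  have F1: "f1 has_fps_expansion fps_deriv F"
  proof (rule iffD1[OF has_fps_expansion_cong has_fps_expansion_deriv[OF F]])
    show "eventually (\<lambda>z. deriv f z = f1 z) (nhds 0)"
      using ev by eventually_elim (rule DERIV_imp_deriv[OF d1])
  qed auto
  have F2: "f2 has_fps_expansion fps_deriv (fps_deriv F)"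
  proof (rule iffD1[OF has_fps_expansion_cong has_fps_expansion_deriv[OF F1]])
    show "eventually (\<lambda>z. deriv f1 z = f2 z) (nhds 0)"
      using ev by eventually_elim (rule DERIV_imp_deriv[OF d2])
  qed auto
  have "(\<lambda>z. z * (1 - z) * f2 z + (c - (a + b + 1) * z) * f1 z - a * b * f z) has_fps_expansion 0"
    unfolding has_fps_expansion_0_iff using ev by eventually_elim (rule ode)
  with has_fps_expansion_hypergeo_op[OF F F1 F2] have "hypergeo_op a b c F = 0"
    by (rule fps_expansion_unique_complex)
  moreover have "fps_nth F 0 = 1"
    using f0 by (simp add: F_def fps_expansion_def)
  ultimately have "F = gauss_fps a b c"
    by (rule hypergeo_op_unique[OF c])
  with F show ?thesis by simp
qed

section \<open>The degree-four transformation\<close>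

text \<open>
  The composite of \<open>z \<mapsto> 4 * z / (1 + z)^2\<close> with \<open>y \<mapsto> 4 * y * (1 - y)\<close>. The
  functions \<open>pullback1\<close> and \<open>pullback2\<close> are its derivatives, needed in closed form for the chain rule.
\<close>
definition pullback :: "complex \<Rightarrow> complex" where
  "pullback z = 16 * z * (1 - z) ^ 2 / (1 + z) ^ 4"

definition pullback1 :: "complex \<Rightarrow> complex" where
  "pullback1 z = 16 * (1 - z) * (1 - 6 * z + z ^ 2) / (1 + z) ^ 5"

definition pullback2 :: "complex \<Rightarrow> complex" where
  "pullback2 z = 16 * (((1 - z) * (2 * z - 6) - (1 - 6 * z + z ^ 2)) * (1 + z)
                         - 5 * (1 - z) * (1 - 6 * z + z ^ 2)) / (1 + z) ^ 6"

lemma has_field_derivative_pullback: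
  assumes "1 + z \<noteq> 0"
  shows "(pullback has_field_derivative pullback1 z) (at z)"
        "(pullback1 has_field_derivative pullback2 z) (at z)"
proof -
  show "(pullback has_field_derivative pullback1 z) (at z)"
    unfolding pullback_def [abs_def] pullback1_def using assms
    by (auto intro!: derivative_eq_intros simp: divide_simps) algebra
  show "(pullback1 has_field_derivative pullback2 z) (at z)"
    unfolding pullback1_def [abs_def] pullback2_def using assms
    by (auto intro!: derivative_eq_intros simp: divide_simps) algebra
qed

text \<open>
  Substituting \<open>(1 + z) powr (-p) * G (pullback z)\<close> into the equation with parameters
  \<open>p\<close>, \<open>a\<close>, \<open>a + 1/2\<close> gives a combination of the second, first and zeroth derivative of \<open>G\<close>.
  The three identities say that its coefficients are a common multiple,
  by \<open>16 * (1 - z) / (1 + z)^2\<close>, of those in the equation with parameters \<open>a/2 - 1/8\<close>,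
  \<open>a/2 + 1/8\<close>, \<open>a + 1/2\<close> at the point \<open>pullback z\<close>.
\<close>
lemma pullback_identities:
  assumes q: "1 + z \<noteq> 0" and p: "p = 2 * a - 1/2"
  shows "z * (1 - z) * pullback1 z ^ 2 = 16 * (1 - z) / (1 + z) ^ 2 * (pullback z * (1 - pullback z))"
    and "z * (1 - z) * (pullback2 z - 2 * p * pullback1 z / (1 + z))
             + (a + 1/2 - (p + a + 1) * z) * pullback1 z =
           16 * (1 - z) / (1 + z) ^ 2 * (a + 1/2 - (a + 1) * pullback z)"
    and "z * (1 - z) * (p * (p + 1) / (1 + z) ^ 2) - (a + 1/2 - (p + a + 1) * z) * (p / (1 + z)) - p * a =
           - (16 * (1 - z) / (1 + z) ^ 2 * ((a / 2 - 1/8) * (a / 2 + 1/8)))"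
proof -
  define u where "u = inverse (1 + z)"
  have uq: "u * (1 + z) = 1" using q by (simp add: u_def)
  have w: "pullback z = 16 * z * (1 - z) ^ 2 * u ^ 4"
    and w1: "pullback1 z = 16 * (1 - z) * (1 - 6 * z + z ^ 2) * u ^ 5"
    and w2: "pullback2 z = 16 * (((1 - z) * (2 * z - 6) - (1 - 6 * z + z ^ 2)) * (1 + z)
                                  - 5 * (1 - z) * (1 - 6 * z + z ^ 2)) * u ^ 6"
    and d: "x / (1 + z) = x * u" "x / (1 + z) ^ 2 = x * u ^ 2" for x
    by (simp_all add: pullback_def pullback1_def pullback2_def u_def divide_inverse power_inverse)
  show "z * (1 - z) * pullback1 z ^ 2 = 16 * (1 - z) / (1 + z) ^ 2 * (pullback z * (1 - pullback z))"
    unfolding d w w1 using uq by algebra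
  show "z * (1 - z) * (pullback2 z - 2 * p * pullback1 z / (1 + z))
             + (a + 1/2 - (p + a + 1) * z) * pullback1 z =
           16 * (1 - z) / (1 + z) ^ 2 * (a + 1/2 - (a + 1) * pullback z)"
    unfolding d w w1 w2 p using uq by algebra
  show "z * (1 - z) * (p * (p + 1) / (1 + z) ^ 2) - (a + 1/2 - (p + a + 1) * z) * (p / (1 + z)) - p * a =
           - (16 * (1 - z) / (1 + z) ^ 2 * ((a / 2 - 1/8) * (a / 2 + 1/8)))"
  proof -
    (* homogenise in u, using u * (1 + z) = 1, so that a polynomial identity remains *)
    have "z * (1 - z) * (p * (p + 1) * u ^ 2) - (a + 1/2 - (p + a + 1) * z) * (p * u) - p * a =
          z * (1 - z) * (p * (p + 1) * u ^ 2) - (a + 1/2 - (p + a + 1) * z) * (p * u * (u * (1 + z)))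
            - p * a * (u * (1 + z)) ^ 2"
      by (simp add: uq)
    also have "\<dots> = - (16 * (1 - z) * u ^ 2 * ((a / 2 - 1/8) * (a / 2 + 1/8)))"
      unfolding p by (simp add: field_simps; algebra)
    finally show ?thesis unfolding d .
  qed
qed

text \<open>
  The region where both hypergeometric series in the transformation converge. It is not
  connected: \<open>pullback\<close> is small again near its double zero \<open>1\<close>, beyond the point where the
  special value is taken. The transformation is therefore asserted on the component of \<open>0\<close> only.
\<close>
definition pullback_dom :: "complex set" where
  "pullback_dom = ball 0 1 \<inter> pullback -` ball 0 1"

lemma one_plus_notin_nonpos_Reals:
  assumes "z \<in> ball (0 :: complex) 1"
  shows "1 + z \<notin> \<real>\<^sub>\<le>\<^sub>0"
  using assms abs_Re_le_cmod[of z] by (auto simp: complex_nonpos_Reals_iff)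

lemma one_plus_neq_0:
  assumes "z \<in> ball (0 :: complex) 1"
  shows "1 + z \<noteq> 0"
  using one_plus_notin_nonpos_Reals[OF assms] by auto

lemma pullback_holomorphic: "pullback holomorphic_on ball 0 1"
  unfolding pullback_def [abs_def] by (intro holomorphic_intros) (use one_plus_neq_0 in auto)

lemma open_pullback_dom: "open pullback_dom"
  unfolding pullback_dom_def
  by (intro continuous_open_preimage holomorphic_on_imp_continuous_on pullback_holomorphic) auto

text \<open>
  The right-hand side solves, near \<open>0\<close>, the equation of the left-hand side and has value \<open>1\<close>
  at \<open>0\<close>, so the two expansions at \<open>0\<close> agree; the identity theorem carries the equality to
  the whole component.
\<close>
lemma gauss_F_pullback:
  assumes c: "a + 1/2 \<notin> \<int>\<^sub>\<le>\<^sub>0" and p: "p = 2 * a - 1/2"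
    and z: "z \<in> connected_component_set pullback_dom 0"
  shows "gauss_F p a (a + 1/2) z =
           (1 + z) powr (-p) * gauss_F (a / 2 - 1/8) (a / 2 + 1/8) (a + 1/2) (pullback z)"
proof -
  define G where "G = gauss_F (a / 2 - 1/8) (a / 2 + 1/8) (a + 1/2)"
  define G1 where "G1 = deriv G"
  define G2 where "G2 = deriv G1"
  define Q where "Q = (\<lambda>z :: complex. (1 + z) powr (-p))"
  define f where "f = (\<lambda>z. Q z * G (pullback z))"
  define f1 where "f1 = (\<lambda>z. Q z * (pullback1 z * G1 (pullback z) - p / (1 + z) * G (pullback z)))"
  define f2 where "f2 = (\<lambda>z. Q z * (pullback1 z ^ 2 * G2 (pullback z)
     + (pullback2 z - 2 * p * pullback1 z / (1 + z)) * G1 (pullback z)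
     + p * (p + 1) / (1 + z) ^ 2 * G (pullback z)))"
  have holG: "G holomorphic_on ball 0 1"
    unfolding G_def by (rule holomorphic_gauss_F[OF c])
  hence holG1: "G1 holomorphic_on ball 0 1"
    unfolding G1_def by (rule holomorphic_deriv) auto
  have dG: "(G has_field_derivative G1 w) (at w)" "(G1 has_field_derivative G2 w) (at w)"
    if "w \<in> ball 0 1" for w
    unfolding G1_def G2_def
    using holomorphic_derivI[OF holG _ that] holomorphic_derivI[OF holG1 _ that]
    by (auto simp: G1_def)
  have dQ: "(Q has_field_derivative (- p / (1 + z) * Q z)) (at z)" if "z \<in> ball 0 1" for z
    unfolding Q_def using one_plus_notin_nonpos_Reals[OF that] one_plus_neq_0[OF that]
    by (auto intro!: derivative_eq_intros simp: powr_diff)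
  have dGp: "((\<lambda>z. G (pullback z)) has_field_derivative G1 (pullback z) * pullback1 z) (at z)"
            "((\<lambda>z. G1 (pullback z)) has_field_derivative G2 (pullback z) * pullback1 z) (at z)"
    if "z \<in> pullback_dom" for z
    using that
    by (auto intro!: DERIV_chain2[OF dG(1)] DERIV_chain2[OF dG(2)] has_field_derivative_pullback one_plus_neq_0
             simp: pullback_dom_def)
  have df: "(f has_field_derivative f1 z) (at z)" if "z \<in> pullback_dom" for z
  proof -
    have z: "z \<in> ball 0 1" using that by (simp add: pullback_dom_def)
    show ?thesis
      unfolding f_def f1_def
      by (rule DERIV_cong[OF DERIV_mult[OF dQ[OF z] dGp(1)[OF that]]]) (simp add: algebra_simps)
  qed
  have df1: "(f1 has_field_derivative f2 z) (at z)" if "z \<in> pullback_dom" for z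
  proof -
    have z: "z \<in> ball 0 1" using that by (simp add: pullback_dom_def)
    have dp: "((\<lambda>z. p / (1 + z)) has_field_derivative (- p / (1 + z) ^ 2)) (at z)"
      using one_plus_neq_0[OF z] by (auto intro!: derivative_eq_intros simp: power2_eq_square)
    show ?thesis
      unfolding f1_def f2_def
      by (rule DERIV_cong[OF DERIV_mult[OF dQ[OF z] DERIV_diff[OF
             DERIV_mult[OF has_field_derivative_pullback(2)[OF one_plus_neq_0[OF z]] dGp(2)[OF that]]
             DERIV_mult[OF dp dGp(1)[OF that]]]]])
         (use one_plus_neq_0[OF z] in \<open>simp add: divide_simps; algebra\<close>)
  qed
  have ode: "z * (1 - z) * f2 z + (a + 1/2 - (p + a + 1) * z) * f1 z - p * a * f z = 0"
    if "z \<in> pullback_dom" for z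
  proof -
    have z: "z \<in> ball 0 1" and wz: "pullback z \<in> ball 0 1"
      using that by (simp_all add: pullback_dom_def)
    define K0 K1 K2 where "K0 = G (pullback z)" "K1 = G1 (pullback z)" "K2 = G2 (pullback z)"
    note I = pullback_identities[OF one_plus_neq_0[OF z] p]
    define M where "M = 16 * (1 - z) / (1 + z) ^ 2"
    have "pullback z * (1 - pullback z) * K2 + (a + 1/2 - (a + 1) * pullback z) * K1
            - (a / 2 - 1/8) * (a / 2 + 1/8) * K0 = 0"
      using gauss_F_ode[OF c wz, of "a / 2 - 1/8" "a / 2 + 1/8"]
      by (simp add: K0_K1_K2_def G_def G1_def G2_def)
    hence "0 = Q z * M * (pullback z * (1 - pullback z) * K2 + (a + 1/2 - (a + 1) * pullback z) * K1
            - (a / 2 - 1/8) * (a / 2 + 1/8) * K0)"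
      by simp
    also have "\<dots> = Q z * ((M * (pullback z * (1 - pullback z))) * K2
        + (M * (a + 1/2 - (a + 1) * pullback z)) * K1
        + (- (M * ((a / 2 - 1/8) * (a / 2 + 1/8)))) * K0)"
      by algebra
    also have "\<dots> = z * (1 - z) * f2 z + (a + 1/2 - (p + a + 1) * z) * f1 z - p * a * f z"
      unfolding M_def I [symmetric] f_def f1_def f2_def K0_K1_K2_def [symmetric]
      by (simp only: algebra_simps)
    finally show ?thesis by simp
  qed
  have dom0: "0 \<in> pullback_dom"
    by (simp add: pullback_dom_def pullback_def)
  then obtain r where r: "r > 0" "ball 0 r \<subseteq> pullback_dom"
    using open_pullback_dom by (auto simp: open_contains_ball)
  have "f has_fps_expansion gauss_fps p a (a + 1/2)"
  proof (rule has_fps_expansion_gauss_fpsI[OF c r(1)])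
    show "f 0 = 1"
      by (simp add: f_def Q_def G_def pullback_def gauss_F_eq_eval_fps eval_fps_at_0 gauss_fps_nth_0)
  qed (use df df1 ode r(2) in blast)+
  hence "(\<lambda>z. gauss_F p a (a + 1/2) z - f z) has_fps_expansion 0"
    using has_fps_expansion_diff[OF has_fps_expansion_gauss_F[OF c, of p a]] by fastforce
  moreover have "(\<lambda>z. gauss_F p a (a + 1/2) z - f z) holomorphic_on pullback_dom"
  proof (intro holomorphic_on_diff)
    show "f holomorphic_on pullback_dom"
      using df unfolding holomorphic_on_open[OF open_pullback_dom] by blast
    show "gauss_F p a (a + 1/2) holomorphic_on pullback_dom"
      by (rule holomorphic_on_subset[OF holomorphic_gauss_F[OF c]]) (auto simp: pullback_dom_def)
  qed
  hence "(\<lambda>z. gauss_F p a (a + 1/2) z - f z) holomorphic_on connected_component_set pullback_dom 0"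
    by (rule holomorphic_on_subset) (rule connected_component_subset)
  ultimately have "gauss_F p a (a + 1/2) z - f z = 0"
    by (rule has_fps_expansion_0_analytic_continuation)
       (use z dom0 open_pullback_dom in \<open>auto intro: open_connected_component connected_component_refl\<close>)
  thus ?thesis by (simp add: f_def Q_def G_def)
qed

section \<open>The special value\<close>

text \<open>
  The form \<open>1 - D^2\<close> shows that the map stays below \<open>1\<close> on the positive axis except at the zeros of
  \<open>1 - 6 * t + t^2\<close>, where it touches \<open>1\<close>.
\<close>
lemma pullback_of_real:
  fixes t :: real
  assumes "t \<ge> 0"
  shows "pullback (of_real t) = of_real (1 - ((1 - 6 * t + t ^ 2) / (1 + t) ^ 2) ^ 2)"
proof -
  have "1 - ((1 - 6 * t + t ^ 2) / (1 + t) ^ 2) ^ 2 = 16 * t * (1 - t) ^ 2 / (1 + t) ^ 4"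
    using assms by (simp add: divide_simps; algebra)
  thus ?thesis by (simp add: pullback_def)
qed

lemma norm_pullback_of_real:
  fixes t :: real
  assumes "0 \<le> t"
  shows "norm (pullback (of_real t)) \<le> 1"
        "1 - 6 * t + t ^ 2 \<noteq> 0 \<Longrightarrow> norm (pullback (of_real t)) < 1"
proof -
  define D where "D = (1 - 6 * t + t ^ 2) / (1 + t) ^ 2"
  have "1 - D ^ 2 = 16 * t * (1 - t) ^ 2 / (1 + t) ^ 4"
    using assms unfolding D_def by (simp add: divide_simps; algebra)
  also have "\<dots> \<ge> 0" using assms by simp
  finally have D: "norm (pullback (of_real t)) = 1 - D ^ 2"
    using assms by (simp only: pullback_of_real norm_of_real D_def)
  thus "norm (pullback (of_real t)) \<le> 1" by simp
  assume "1 - 6 * t + t ^ 2 \<noteq> 0"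
  with assms have "D \<noteq> 0" by (auto simp: D_def)
  with D show "norm (pullback (of_real t)) < 1" by simp
qed

theorem mainTheorem14:
  fixes a :: complex
  assumes "a + 1/2 \<notin> \<int>\<^sub>\<le>\<^sub>0"
  shows "gauss_F a (2 * a - 1/2) (a + 1/2) (of_real (3 - 2 * sqrt 2)) =
           of_real 2 powr (3/4 - 3 * a) * of_real (sqrt 2 - 1) powr (1/2 - 2 * a)
             * of_real (sqrt pi) * Gamma (a + 1/2)
             * rGamma (a / 2 + 3/8) * rGamma (a / 2 + 5/8)"
proof -
  define p where "p = 2 * a - 1/2"
  define c where "c = a + 1/2"
  define x where "x = 3 - 2 * sqrt 2"
  define G where "G = gauss_F (a / 2 - 1/8) (a / 2 + 1/8) c"
  have c: "c \<notin> \<int>\<^sub>\<le>\<^sub>0" using assms by (simp add: c_def)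
  have "sqrt 2 < 3/2"
    by (rule real_less_lsqrt) (auto simp: power2_eq_square)
  hence sqrt2: "sqrt 2 < 3/2" "1 < sqrt 2" by auto
  have x: "0 < x" "x < 1"
    using sqrt2 by (auto simp: x_def)
  have root: "1 - 6 * t + t ^ 2 = (x - t) * (3 + 2 * sqrt 2 - t)" for t
    using real_sqrt_pow2[of 2] unfolding x_def by (simp add: algebra_simps power2_eq_square)
  have path: "of_real t \<in> connected_component_set pullback_dom 0" if t: "t \<in> {0..<x}" for t
  proof -
    have "complex_of_real ` {0..t} \<subseteq> connected_component_set pullback_dom 0"
    proof (rule connected_component_maximal)
      show "connected (complex_of_real ` {0..t})"
        by (intro connected_continuous_image continuous_intros) auto
      show "complex_of_real ` {0..t} \<subseteq> pullback_dom"
      proof safe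
        fix s assume s: "s \<in> {0..t}"
        have "1 - 6 * s + s ^ 2 \<noteq> 0"
        proof -
          have "s < x" using s t by simp
          moreover from this have "s < 3 + 2 * sqrt 2"
            using sqrt2 unfolding x_def by linarith
          ultimately show ?thesis unfolding root by simp
        qed
        thus "complex_of_real s \<in> pullback_dom"
          using s t x by (auto simp: pullback_dom_def intro!: norm_pullback_of_real(2))
      qed
    qed (use t in force)
    moreover have "complex_of_real t \<in> complex_of_real ` {0..t}"
      using t by simp
    ultimately show ?thesis by (rule subsetD)
  qed
  have cont_l: "continuous_on {0..x} (\<lambda>t. gauss_F p a c (of_real t))"
    by (rule continuous_on_compose2[OF holomorphic_on_imp_continuous_on[OF holomorphic_gauss_F[OF c]]])
       (use x in \<open>auto intro!: continuous_intros\<close>)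
  have cont_G: "continuous_on {0..x} (\<lambda>t. G (pullback (of_real t)))"
  proof -
    have 1: "continuous_on (cball 0 1) G"
      unfolding G_def by (rule continuous_on_gauss_F[OF c]) (simp add: c_def)
    have 2: "continuous_on {0..x} (\<lambda>t. pullback (of_real t))"
      by (rule continuous_on_compose2[OF holomorphic_on_imp_continuous_on[OF pullback_holomorphic]])
         (use x in \<open>auto intro!: continuous_intros\<close>)
    show ?thesis
      by (rule continuous_on_compose2[OF 1 2]) (auto intro!: norm_pullback_of_real)
  qed
  have cont_r: "continuous_on {0..x} (\<lambda>t. (1 + of_real t) powr (-p) * G (pullback (of_real t)))"
  proof -
    have "1 + complex_of_real t \<noteq> 0" if "t \<ge> 0" for t
      using that by (simp add: complex_eq_iff)
    thus ?thesis
      using x by (intro continuous_intros cont_G) (auto intro!: one_plus_notin_nonpos_Reals)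
  qed
  have eq: "gauss_F p a c (of_real t) = (1 + of_real t) powr (-p) * G (pullback (of_real t))"
    if "t \<in> {0..<x}" for t
    unfolding G_def c_def by (rule gauss_F_pullback[OF assms p_def path[OF that]])
  (* the equality on [0, x) passes to x, where the inner argument reaches the unit circle *)
  have closure: "closure {0..<x} = {0..x}"
    using x by simp
  have "gauss_F p a c (of_real x) - (1 + of_real x) powr (-p) * G (pullback (of_real x)) = 0"
    by (rule continuous_constant_on_closure[where S = "{0..<x}"])
       (use x in \<open>auto simp: closure intro!: continuous_on_diff cont_l cont_r simp: eq\<close>)
  moreover have "pullback (of_real x) = 1"
    using x by (simp add: pullback_of_real root)
  moreover have "G 1 = Gamma c * of_real (sqrt pi) * rGamma (a / 2 + 5/8) * rGamma (a / 2 + 3/8)"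
  proof -
    have "G 1 = Gamma c * Gamma (c - (a / 2 - 1/8) - (a / 2 + 1/8))
                 * rGamma (c - (a / 2 - 1/8)) * rGamma (c - (a / 2 + 1/8))"
      unfolding G_def by (rule gauss_F_1[OF c]) (simp add: c_def)
    moreover have "c - (a / 2 - 1/8) - (a / 2 + 1/8) = 1/2" "c - (a / 2 - 1/8) = a / 2 + 5/8"
              "c - (a / 2 + 1/8) = a / 2 + 3/8"
      by (simp_all add: c_def field_simps)
    ultimately show ?thesis by (metis Gamma_one_half_complex)
  qed
  moreover have "(1 + of_real x) powr (-p) =
      of_real 2 powr (3/4 - 3 * a) * of_real (sqrt 2 - 1) powr (1/2 - 2 * a)"
  proof -
    have "1 + x = 2 * sqrt 2 * (sqrt 2 - 1)"
      by (simp add: x_def algebra_simps)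
    hence "ln (1 + x) = ln (2 * sqrt 2) + ln (sqrt 2 - 1)"
      using sqrt2 by (simp add: ln_mult)
    also have "ln (2 * sqrt 2) = 3 / 2 * ln (2::real)"
      by (simp add: ln_mult ln_sqrt)
    finally have ln: "ln (1 + x) = 3 / 2 * ln 2 + ln (sqrt 2 - 1)" .
    have P: "of_real r powr s = exp (s * of_real (ln r))" if "r > 0" for r :: real and s :: complex
      using that by (simp add: powr_def Ln_of_real)
    have "(1 + of_real x) powr (-p) = of_real (1 + x) powr (-p)" by simp
    also have "\<dots> = exp ((3/4 - 3 * a) * of_real (ln 2) + (1/2 - 2 * a) * of_real (ln (sqrt 2 - 1)))"
    proof (subst P)
      show "exp (- p * of_real (ln (1 + x))) =
              exp ((3/4 - 3 * a) * of_real (ln 2) + (1/2 - 2 * a) * of_real (ln (sqrt 2 - 1)))"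
        by (rule arg_cong[of _ _ exp]) (simp add: ln p_def field_simps)
    qed (use x in auto)
    also have "\<dots> = of_real 2 powr (3/4 - 3 * a) * of_real (sqrt 2 - 1) powr (1/2 - 2 * a)"
      using sqrt2 by (subst (1 2) P) (auto simp: exp_add)
    finally show ?thesis .
  qed
  moreover have "gauss_F a p c = gauss_F p a c"
    by (simp add: gauss_F_def fun_eq_iff mult.commute)
  ultimately show ?thesis
    by (simp add: c_def p_def x_def)
qed

end
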